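(* The price of stochasticity $\phi^*$ is at most $\frac{2}{3}$.
   Context: Let $G=(V,E)$ be a finite simple undirected graph with arrival function $a:V\to\mathbb{N}$ and deadline function $b:V\to\mathbb{N}$, $1\le a_v\le b_v$, such that $[a_u,b_u]\cap[a_v,b_v]\neq\emptyset$ for every edge $uv\in E$; $T=\max_v b_v$. Each vertex $v$ has an independent discrete distribution $P_v$ on $\{a_v,\dots,b_v\}$ from which its death time $d_v$ is drawn; vertex $v$ is alive at the integer times in $[a_v,d_v]$. This is a stochastic arrival-departure model $\mathcal{G}$. An instantiation is the random static subgraph $I$ of $G$ formed by the edges $uv$ whose endpoints are simultaneously alive at some time; $\mathrm{opt}(\mathcal{G})$ is the expected size of a maximum matching of $I$. In the matching process, death times are sampled at time 0 but revealed only after they happen; a snapshot $s$ (present, unmatched, alive vertices) starts empty, and at each time $t=1,\dots,T$: vertices with $a_v=t$ join $s$, the algorithm (possibly randomized, knowing $G,a,b,\{P_v\}$ and the history) irrevocably chooses a matching $M_t$ among edges of $G$ with both endpoints in $s$, these endpoints are removed from $s$, then vertices with $d_v=t$ are removed from $s$. $\chi^*(\mathcal{G})$ is the maximum, over all such adaptive algorithms, of the expected size of the output matching. The price of stochasticity (stochasticity ratio) is $\phi^*=\min_{\mathcal{G}}\chi^*(\mathcal{G})/\mathrm{opt}(\mathcal{G})$, the minimum (infimum) being over all stochastic arrival-departure models. *)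

theory Defs
  imports "HOL-Probability.Probability"
begin

record 'v ad_model =
  verts :: "'v set"
  edges :: "'v set set"
  arrival :: "'v \<Rightarrow> nat"
  deadline :: "'v \<Rightarrow> nat"
  death_dist :: "'v \<Rightarrow> nat pmf"

definition arrival_departure_model :: "'v ad_model \<Rightarrow> bool" where
  "arrival_departure_model G \<longleftrightarrow>
     finite (verts G) \<and>
     (\<forall>e\<in>edges G. e \<subseteq> verts G \<and> card e = 2) \<and>
     (\<forall>v\<in>verts G. 1 \<le> arrival G v \<and> arrival G v \<le> deadline G v) \<and>
     (\<forall>e\<in>edges G. \<forall>u\<in>e. \<forall>v\<in>e.
        {arrival G u..deadline G u} \<inter> {arrival G v..deadline G v} \<noteq> {}) \<and>
     (\<forall>v\<in>verts G. set_pmf (death_dist G v) \<subseteq> {arrival G v..deadline G v})"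

definition horizon :: "'v ad_model \<Rightarrow> nat" where
  "horizon G = Max (deadline G ` verts G)"

text \<open>Death times are drawn independently; the value 0 off the vertex set is a dummy.\<close>

definition death_times :: "'v ad_model \<Rightarrow> ('v \<Rightarrow> nat) pmf" where
  "death_times G = Pi_pmf (verts G) 0 (death_dist G)"

definition matching :: "'v set set \<Rightarrow> 'v set set \<Rightarrow> bool" where
  "matching E M \<longleftrightarrow> M \<subseteq> E \<and> pairwise disjnt M"

definition max_matching_size :: "'v set set \<Rightarrow> nat" where
  "max_matching_size E = Max (card ` {M. matching E M})"

definition instantiation_edges :: "'v ad_model \<Rightarrow> ('v \<Rightarrow> nat) \<Rightarrow> 'v set set" where
  "instantiation_edges G d =
     {e \<in> edges G. \<exists>t. \<forall>v\<in>e. arrival G v \<le> t \<and> t \<le> d v}"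

definition opt :: "'v ad_model \<Rightarrow> real" where
  "opt G = measure_pmf.expectation (death_times G)
             (\<lambda>d. real (max_matching_size (instantiation_edges G d)))"

text \<open>
  An adaptive randomized algorithm for a given model receives the current time, the current
  snapshot, the death times revealed so far, and the list of matchings it chose at the
  earlier times; it answers with a distribution on the matching to choose now.
\<close>

type_synonym 'v policy =
  "nat \<Rightarrow> 'v set \<Rightarrow> ('v \<Rightarrow> nat option) \<Rightarrow> 'v set set list \<Rightarrow> 'v set set pmf"

definition valid_policy :: "'v ad_model \<Rightarrow> 'v policy \<Rightarrow> bool" where
  "valid_policy G \<pi> \<longleftrightarrow>
     (\<forall>t s r Ms. \<forall>M\<in>set_pmf (\<pi> t s r Ms). matching {e \<in> edges G. e \<subseteq> s} M)"

definition revealed_deaths :: "'v ad_model \<Rightarrow> ('v \<Rightarrow> nat) \<Rightarrow> nat \<Rightarrow> 'v \<Rightarrow> nat option" where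
  "revealed_deaths G d t = (\<lambda>v. if v \<in> verts G \<and> d v < t then Some (d v) else None)"

text \<open>The state after time \<open>t\<close>: the snapshot and the list of matchings chosen up to then.\<close>

fun run :: "'v ad_model \<Rightarrow> 'v policy \<Rightarrow> ('v \<Rightarrow> nat) \<Rightarrow> nat \<Rightarrow> ('v set \<times> 'v set set list) pmf" where
  "run G \<pi> d 0 = return_pmf ({}, [])"
| "run G \<pi> d (Suc t) =
     bind_pmf (run G \<pi> d t) (\<lambda>(s, Ms).
       let s' = s \<union> {v \<in> verts G. arrival G v = Suc t} in
       bind_pmf (\<pi> (Suc t) s' (revealed_deaths G d (Suc t)) Ms) (\<lambda>M.
         return_pmf (s' - \<Union>M - {v. d v = Suc t}, Ms @ [M])))"

definition output_matching :: "'v ad_model \<Rightarrow> 'v policy \<Rightarrow> 'v set set pmf" where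
  "output_matching G \<pi> =
     bind_pmf (death_times G) (\<lambda>d.
       map_pmf (\<lambda>(s, Ms). \<Union>(set Ms)) (run G \<pi> d (horizon G)))"

definition policy_value :: "'v ad_model \<Rightarrow> 'v policy \<Rightarrow> real" where
  "policy_value G \<pi> = measure_pmf.expectation (output_matching G \<pi>) (\<lambda>M. real (card M))"

definition chi_star :: "'v ad_model \<Rightarrow> real" where
  "chi_star G = (SUP \<pi>\<in>{\<pi>. valid_policy G \<pi>}. policy_value G \<pi>)"

text \<open>
  Vertices are natural numbers, which covers every finite graph up to isomorphism. Models with
  \<open>opt G = 0\<close> have no ratio and are left out (in HOL the quotient would be 0).
\<close>

definition phi_star :: real where
  "phi_star = (INF G\<in>{G :: nat ad_model. arrival_departure_model G \<and> opt G > 0}.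
                 chi_star G / opt G)"

end

theory Submission
  imports Defs "HOL-Real_Asymp.Real_Asymp"
begin

text \<open>
  Take a clique on \<open>m\<close> vertices arriving at time 1, each dying at time 1 or 2 with probability
  1/2, together with a private partner for each of them that is present only at time 2.
  In hindsight one matches the vertices dying at time 1 among themselves and the others with
  their partners, which gives \<open>3m/4 - O(1)\<close> edges on average. An algorithm that matches \<open>k\<close> pairs
  at time 1 gives up \<open>2k\<close> clique vertices, of which \<open>k\<close> are expected to survive, and each edge
  available at time 2 uses a surviving clique vertex; so its expected gain is at most \<open>m/2\<close>
  whatever \<open>k\<close> is. The ratio tends to 2/3.
\<close>

section \<open>Bounds on \<open>policy_value\<close>, \<open>chi_star\<close> and
  \<open>phi_star\<close> in arbitrary models\<close>

lemma policy_value_nonneg: "policy_value G \<pi> \<ge> 0"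
  unfolding policy_value_def by simp

text \<open>Working with the nonnegative integral avoids integrability side conditions for the
  output of an arbitrary policy.\<close>

lemma policy_value_le:
  assumes "(\<integral>\<^sup>+ M. ennreal (real (card M)) \<partial>output_matching G \<pi>) \<le> ennreal c" "c \<ge> 0"
  shows "policy_value G \<pi> \<le> c"
  unfolding policy_value_def
  by (rule integral_real_bounded) (use assms in auto)

lemma valid_policy_empty: "valid_policy G (\<lambda>_ _ _ _. return_pmf {})"
  by (simp add: valid_policy_def matching_def)

lemma run_chosen_edges:
  assumes "valid_policy G \<pi>" "(s, Ms) \<in> set_pmf (run G \<pi> d t)"
  shows "\<Union>(set Ms) \<subseteq> edges G"
  using assms(2)
proof (induction t arbitrary: s Ms)
  case 0
  then show ?case by simp
next
  case (Suc t)
  then obtain s0 Ms0 M where *: "(s0, Ms0) \<in> set_pmf (run G \<pi> d t)"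
    "M \<in> set_pmf (\<pi> (Suc t) (s0 \<union> {v \<in> verts G. arrival G v = Suc t})
       (revealed_deaths G d (Suc t)) Ms0)" "Ms = Ms0 @ [M]"
    by (auto simp: Let_def split: prod.splits)
  have "M \<subseteq> edges G"
    using assms(1) *(2) unfolding valid_policy_def matching_def by blast
  with Suc.IH[OF *(1)] *(3) show ?case by auto
qed

text \<open>A crude bound, whose purpose is to make the supremum in \<open>chi_star\<close> one over
  a set that is bounded above.\<close>

lemma policy_value_le_card_edges:
  assumes "finite (edges G)" "valid_policy G \<pi>"
  shows "policy_value G \<pi> \<le> real (card (edges G))"
proof (rule policy_value_le)
  have "AE M in output_matching G \<pi>. ennreal (real (card M)) \<le> ennreal (real (card (edges G)))"
    using run_chosen_edges[OF assms(2)] card_mono[OF assms(1)]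
    by (auto simp: AE_measure_pmf_iff output_matching_def)
  then have "(\<integral>\<^sup>+ M. ennreal (real (card M)) \<partial>output_matching G \<pi>)
      \<le> (\<integral>\<^sup>+ M. ennreal (real (card (edges G))) \<partial>output_matching G \<pi>)"
    by (rule nn_integral_mono_AE)
  then show "(\<integral>\<^sup>+ M. ennreal (real (card M)) \<partial>output_matching G \<pi>) \<le> ennreal (real (card (edges G)))"
    by simp
qed simp

lemma finite_edges:
  assumes "arrival_departure_model G"
  shows "finite (edges G)"
proof (rule finite_subset)
  show "edges G \<subseteq> Pow (verts G)" "finite (Pow (verts G))"
    using assms unfolding arrival_departure_model_def by auto
qed

text \<open>The policy that never matches is valid. The resulting bound shows that the ratios in
  \<open>phi_star\<close> are bounded below, so that each model bounds their infimum from
  above.\<close>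

lemma chi_star_nonneg:
  assumes "arrival_departure_model G"
  shows "chi_star G \<ge> 0"
proof -
  have "policy_value G (\<lambda>_ _ _ _. return_pmf {}) \<le> chi_star G"
    unfolding chi_star_def
    using policy_value_le_card_edges[OF finite_edges[OF assms]] valid_policy_empty
    by (intro cSUP_upper bdd_aboveI2[where M = "real (card (edges G))"]) auto
  then show ?thesis using policy_value_nonneg order_trans by blast
qed

lemma chi_star_le:
  assumes "\<And>\<pi>. valid_policy G \<pi> \<Longrightarrow> policy_value G \<pi> \<le> c"
  shows "chi_star G \<le> c"
  unfolding chi_star_def using assms valid_policy_empty by (intro cSUP_least) auto

lemma phi_star_le:
  fixes G :: "nat ad_model"
  assumes "arrival_departure_model G" "opt G > 0"
  shows "phi_star \<le> chi_star G / opt G"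
  unfolding phi_star_def using assms
  by (intro cINF_lower bdd_belowI2[where m = 0]) (auto intro: divide_nonneg_pos chi_star_nonneg)

section \<open>Sizes of matchings in finite graphs\<close>

lemma card_le_max_matching_size:
  assumes "finite E" "matching E M"
  shows "card M \<le> max_matching_size E"
proof -
  have "finite {M. matching E M}"
    by (rule finite_subset[of _ "Pow E"]) (use assms in \<open>auto simp: matching_def\<close>)
  with assms(2) show ?thesis unfolding max_matching_size_def by (intro Max_ge) auto
qed

text \<open>Any two vertices can be taken as an edge; induction matches the remaining ones.\<close>

lemma near_perfect_matching_complete_graph:
  assumes "finite D"
  shows "\<exists>M. matching {e. e \<subseteq> D \<and> card e = 2} M \<and> card M = card D div 2"
  using assms
proof (induction "card D" arbitrary: D rule: less_induct)
  case less
  show ?case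
  proof (cases "card D < 2")
    case True
    then show ?thesis by (intro exI[of _ "{}"]) (auto simp: matching_def)
  next
    case False
    then obtain e where e: "e \<subseteq> D" "card e = 2"
      by (meson not_less obtain_subset_with_card_n)
    have "finite e" using e less.prems finite_subset by blast
    then have c: "card (D - e) = card D - 2" using e by (simp add: card_Diff_subset)
    with False obtain M where M: "matching {e'. e' \<subseteq> D - e \<and> card e' = 2} M"
      "card M = card (D - e) div 2"
      using less.hyps[of "D - e"] less.prems by auto
    have sub: "\<And>x. x \<in> M \<Longrightarrow> x \<subseteq> D - e \<and> card x = 2" and dj: "pairwise disjnt M"
      using M(1) by (auto simp: matching_def)
    have "finite M" by (rule finite_subset[of _ "Pow D"]) (use sub less.prems in auto)
    moreover have "e \<notin> M" proof
      assume "e \<in> M"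
      then have "e = {}" using sub by blast
      then show False using e(2) by simp
    qed
    ultimately have "card (insert e M) = card D div 2" using M(2) c False by simp
    moreover have "matching {e. e \<subseteq> D \<and> card e = 2} (insert e M)"
      using sub dj e by (fastforce simp: matching_def pairwise_insert disjnt_def)
    ultimately show ?thesis by blast
  qed
qed

text \<open>Choosing a point of \<open>X\<close> in each edge is injective, because the edges are
  disjoint.\<close>

lemma card_matching_le_card_transversal:
  assumes "pairwise disjnt M" "finite X" "\<And>e. e \<in> M \<Longrightarrow> e \<inter> X \<noteq> {}"
  shows "card M \<le> card X"
proof -
  obtain f where f: "\<And>e. e \<in> M \<Longrightarrow> f e \<in> e \<inter> X"
    using bchoice[of M "\<lambda>e x. x \<in> e \<inter> X"] assms(3) by (metis all_not_in_conv)
  have "inj_on f M"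
  proof (rule inj_onI, rule ccontr)
    fix e e' assume e: "e \<in> M" "e' \<in> M" "f e = f e'" "e \<noteq> e'"
    then have "e \<inter> e' = {}" using assms(1) by (simp add: pairwise_def disjnt_def)
    then show False using f[OF e(1)] f[OF e(2)] e(3) by auto
  qed
  then show ?thesis using f assms(2) by (intro card_inj_on_le[of f]) auto
qed

lemma card_Union_matching:
  assumes "pairwise disjnt M" "\<And>e. e \<in> M \<Longrightarrow> card e = 2"
  shows "card (\<Union>M) = 2 * card M"
proof -
  have "card (\<Union>M) = sum card M"
    using assms by (intro card_Union_disjoint) (auto intro: card_ge_0_finite)
  then show ?thesis using assms(2) by simp
qed

section \<open>The hard instance and its death times\<close>

text \<open>The partner of the clique vertex \<open>v\<close> is \<open>v + m\<close>. All lifetime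
  intervals contain time 2, so every edge joins overlapping intervals.\<close>

definition clique_with_pendants :: "nat \<Rightarrow> nat ad_model" where
  "clique_with_pendants m = \<lparr>
     verts = {..<2*m},
     edges = {e. e \<subseteq> {..<m} \<and> card e = 2} \<union> (\<lambda>v. {v, v + m}) ` {..<m},
     arrival = (\<lambda>v. if v < m then 1 else 2),
     deadline = (\<lambda>_. 2),
     death_dist = (\<lambda>v. if v < m then pmf_of_set {1, 2} else return_pmf 2)\<rparr>"

lemma clique_with_pendants_simps [simp]:
  "verts (clique_with_pendants m) = {..<2*m}"
  "edges (clique_with_pendants m) =
     {e. e \<subseteq> {..<m} \<and> card e = 2} \<union> (\<lambda>v. {v, v + m}) ` {..<m}"
  "arrival (clique_with_pendants m) = (\<lambda>v. if v < m then 1 else 2)"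
  "deadline (clique_with_pendants m) = (\<lambda>_. 2)"
  "death_dist (clique_with_pendants m) = (\<lambda>v. if v < m then pmf_of_set {1, 2} else return_pmf 2)"
  by (simp_all add: clique_with_pendants_def)

lemma model_clique_with_pendants: "arrival_departure_model (clique_with_pendants m)"
  by (auto simp: arrival_departure_model_def card_insert_if subset_eq)

lemma horizon_clique_with_pendants: "m > 0 \<Longrightarrow> horizon (clique_with_pendants m) = 2"
  by (simp add: horizon_def image_constant_conv lessThan_empty_iff)

lemma death_times_support:
  assumes "d \<in> set_pmf (death_times (clique_with_pendants m))" "v < 2 * m"
  shows "d v = 2 \<or> v < m \<and> d v = 1"
  using assms
  by (auto simp: death_times_def set_Pi_pmf PiE_dflt_def split: if_splits)

text \<open>Finite support makes every real function of the death times integrable.\<close>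

lemma finite_set_death_times: "finite (set_pmf (death_times (clique_with_pendants m)))"
  unfolding death_times_def
  by (simp add: set_Pi_pmf) (intro finite_PiE_dflt; auto)

text \<open>Linearity of expectation over survival indicators: the death time of each clique vertex
  is uniform on \<open>{1, 2}\<close>.\<close>

lemma expected_survivors:
  assumes "S \<subseteq> {..<m}"
  shows "measure_pmf.expectation (death_times (clique_with_pendants m))
           (\<lambda>d. real (card {v \<in> S. d v = 2})) = real (card S) / 2"
proof -
  let ?p = "death_times (clique_with_pendants m)"
  have fin: "finite S" using assms finite_subset by blast
  have int: "integrable ?p f" for f :: "_ \<Rightarrow> real"
    by (rule integrable_measure_pmf_finite[OF finite_set_death_times])
  have half: "measure_pmf.expectation ?p (\<lambda>d. of_bool (d v = 2)) = (1/2 :: real)" if "v \<in> S" for v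
  proof -
    have v: "v < m" using that assms by auto
    have "measure_pmf.expectation ?p (\<lambda>d. of_bool (d v = 2) :: real) =
        measure_pmf.expectation (map_pmf (\<lambda>d. d v) ?p) (\<lambda>x. of_bool (x = 2))"
      by simp
    also have "map_pmf (\<lambda>d. d v) ?p = pmf_of_set {1, 2}"
      using v unfolding death_times_def by (subst Pi_pmf_component) auto
    also have "measure_pmf.expectation (pmf_of_set {1, 2}) (\<lambda>x. of_bool (x = (2::nat))) = (1/2::real)"
      by (subst integral_pmf_of_set) auto
    finally show ?thesis .
  qed
  have "real (card {v \<in> S. d v = 2}) = (\<Sum>v\<in>S. of_bool (d v = 2))" for d :: "nat \<Rightarrow> nat"
    using fin by (simp add: Int_def)
  then show ?thesis by (simp add: int half cong: sum.cong)
qed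

section \<open>The hindsight optimum of the hard instance\<close>

text \<open>With \<open>S\<close> the survivors, \<open>N\<close> joins them to their partners and
  \<open>M\<close> pairs up the rest of the clique. The summand \<open>- 1 / 2\<close> pays for the
  vertex left over when that rest is odd.\<close>

lemma matching_size_lower_bound:
  assumes d: "d \<in> set_pmf (death_times (clique_with_pendants m))"
  shows "real m / 2 - 1 / 2 + real (card {v \<in> {..<m}. d v = 2}) / 2 \<le>
         real (max_matching_size (instantiation_edges (clique_with_pendants m) d))"
proof -
  define S where "S = {v \<in> {..<m}. d v = 2}"
  define D where "D = {..<m} - S"
  have fin: "finite S" "finite D" and sub: "S \<subseteq> {..<m}" by (auto simp: S_def D_def)
  have cD: "card D = m - card S" "card S \<le> m"
    using card_Diff_subset[OF fin(1) sub] card_mono[OF _ sub] by (auto simp: D_def)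
  obtain M where M: "matching {e. e \<subseteq> D \<and> card e = 2} M" "card M = card D div 2"
    using near_perfect_matching_complete_graph[OF fin(2)] by blast
  define N where "N = (\<lambda>v. {v, v + m}) ` S"
  have MD: "\<And>e. e \<in> M \<Longrightarrow> e \<subseteq> D \<and> card e = 2" and dj: "pairwise disjnt M"
    using M(1) by (auto simp: matching_def)
  have "finite M" by (rule finite_subset[of _ "Pow D"]) (use MD fin in auto)
  have "inj_on (\<lambda>v. {v, v + m}) S"
    using sub by (auto simp: inj_on_def doubleton_eq_iff)
  then have cN: "card N = card S" by (simp add: N_def card_image)
  have disj: "disjnt e f" if "e \<in> M" "f \<in> N" for e f
    using that MD[of e] by (auto simp: N_def D_def disjnt_def)
  have "M \<inter> N = {}"
    using disj MD by (fastforce simp: disjnt_def)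
  have "pairwise disjnt (M \<union> N)"
  proof -
    have "pairwise disjnt N" using sub by (auto simp: N_def pairwise_def disjnt_def)
    then show ?thesis using dj disj by (auto simp: pairwise_def disjnt_sym)
  qed
  moreover have "M \<union> N \<subseteq> instantiation_edges (clique_with_pendants m) d"
  proof -
    \<comment> \<open>Clique vertices are all alive at time 1, which witnesses the edges of
      \<open>M\<close>; those of \<open>N\<close> are witnessed at time 2.\<close>
    have "e \<in> instantiation_edges (clique_with_pendants m) d" if "e \<in> M" for e
    proof -
      have "1 \<le> d v" if "v \<in> e" for v
        using MD[OF \<open>e \<in> M\<close>] that death_times_support[OF d, of v] by (force simp: D_def)
      then show ?thesis using MD[OF that]
        by (auto simp: instantiation_edges_def D_def intro!: exI[of _ 1])
    qed
    moreover have "e \<in> instantiation_edges (clique_with_pendants m) d" if "e \<in> N" for e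
    proof -
      obtain v where v: "e = {v, v + m}" "v < m" "d v = 2" using \<open>e \<in> N\<close> by (auto simp: N_def S_def)
      moreover have "d (v + m) = 2" using v death_times_support[OF d, of "v + m"] by auto
      ultimately show ?thesis by (auto simp: instantiation_edges_def intro!: exI[of _ 2])
    qed
    ultimately show ?thesis by blast
  qed
  moreover have "finite (instantiation_edges (clique_with_pendants m) d)"
    using finite_edges[OF model_clique_with_pendants, of m]
    by (auto simp: instantiation_edges_def)
  ultimately have "card (M \<union> N) \<le> max_matching_size (instantiation_edges (clique_with_pendants m) d)"
    by (intro card_le_max_matching_size) (auto simp: matching_def)
  moreover have "card (M \<union> N) = (m - card S) div 2 + card S"
    using \<open>finite M\<close> \<open>M \<inter> N = {}\<close> fin M(2) cN cD by (simp add: card_Un_disjoint N_def)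
  moreover have "real m / 2 - 1 / 2 + real (card S) / 2 \<le> real ((m - card S) div 2 + card S)"
    using cD(2) by linarith
  ultimately show ?thesis unfolding S_def by linarith
qed

lemma opt_lower_bound: "opt (clique_with_pendants m) \<ge> 3 * real m / 4 - 1 / 2"
proof -
  let ?p = "death_times (clique_with_pendants m)"
  have int: "integrable ?p f" for f :: "_ \<Rightarrow> real"
    by (rule integrable_measure_pmf_finite[OF finite_set_death_times])
  have "measure_pmf.expectation ?p (\<lambda>d. real m / 2 - 1 / 2 + real (card {v \<in> {..<m}. d v = 2}) / 2)
      \<le> opt (clique_with_pendants m)"
    unfolding opt_def
    by (intro integral_mono_AE int) (use matching_size_lower_bound in \<open>simp add: AE_measure_pmf_iff\<close>)
  also have "measure_pmf.expectation ?p (\<lambda>d. real m / 2 - 1 / 2 + real (card {v \<in> {..<m}. d v = 2}) / 2)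
      = real m / 2 - 1 / 2 + (real m / 2) / 2"
    using expected_survivors[of "{..<m}" m] by (simp add: int)
  finally show ?thesis by simp
qed

section \<open>The upper bound for every policy on the hard instance\<close>

text \<open>Partners are pairwise nonadjacent, so every edge contains a clique vertex. At time 2
  that vertex must be unmatched and a survivor, so these vertices form a transversal of
  \<open>M'\<close>.\<close>

lemma second_round_bound:
  assumes d: "d \<in> set_pmf (death_times (clique_with_pendants m))"
    and M': "matching {e \<in> edges (clique_with_pendants m).
           e \<subseteq> ({..<m} - \<Union>M - {v. d v = 1}) \<union> {m..<2*m}} M'"
  shows "card M' \<le> card {v \<in> {..<m} - \<Union>M. d v = 2}"
proof (rule card_matching_le_card_transversal)
  show "pairwise disjnt M'" using M' by (simp add: matching_def)
  fix e assume "e \<in> M'"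
  then have e: "e \<in> edges (clique_with_pendants m)"
    "e \<subseteq> ({..<m} - \<Union>M - {v. d v = 1}) \<union> {m..<2*m}"
    using M' by (auto simp: matching_def)
  obtain v where v: "v \<in> e" "v < m"
    using e(1) by (auto simp: card_2_iff)
  then have "v \<in> {..<m} - \<Union>M" "d v \<noteq> 1" using e(2) by auto
  then show "e \<inter> {v \<in> {..<m} - \<Union>M. d v = 2} \<noteq> {}"
    using v death_times_support[OF d, of v] by auto
qed auto

text \<open>The first matching is chosen without information on the death times, so it can be fixed
  before averaging over them.\<close>

lemma policy_value_clique_with_pendants:
  assumes m: "m > 0" and \<pi>: "valid_policy (clique_with_pendants m) \<pi>"
  shows "policy_value (clique_with_pendants m) \<pi> \<le> real m / 2"
proof (rule policy_value_le)
  let ?G = "clique_with_pendants m"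
  let ?p = "death_times ?G"
  define p1 where "p1 = \<pi> 1 {..<m} (\<lambda>_. None) []"
  define p2 where "p2 = (\<lambda>d M. \<pi> 2 (({..<m} - \<Union>M - {v. d v = 1}) \<union> {m..<2*m})
      (revealed_deaths ?G d 2) [M])"
  have "output_matching ?G \<pi> =
      bind_pmf ?p (\<lambda>d. bind_pmf p1 (\<lambda>M. map_pmf (\<lambda>M'. M \<union> M') (p2 d M)))"
    unfolding output_matching_def
  proof (intro bind_pmf_cong refl)
    fix d assume d: "d \<in> set_pmf ?p"
    \<comment> \<open>Nobody dies before time 1, and the dummy value 0 off the vertex set is never
      revealed. Hence \<open>p1\<close> does not depend on \<open>d\<close>.\<close>
    have "revealed_deaths ?G d 1 = (\<lambda>_. None)"
      using death_times_support[OF d] by (fastforce simp: revealed_deaths_def)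
    moreover have "{v \<in> verts ?G. arrival ?G v = Suc 0} = {..<m}"
      "{v \<in> verts ?G. arrival ?G v = Suc (Suc 0)} = {m..<2*m}" by auto
    ultimately show "map_pmf (\<lambda>(s, Ms). \<Union>(set Ms)) (run ?G \<pi> d (horizon ?G)) =
        bind_pmf p1 (\<lambda>M. map_pmf (\<lambda>M'. M \<union> M') (p2 d M))"
      using m
      by (simp add: horizon_clique_with_pendants numeral_2_eq_2 map_pmf_def bind_assoc_pmf
          bind_return_pmf p1_def p2_def Let_def del: clique_with_pendants_simps)
  qed
  \<comment> \<open>As \<open>p1\<close> is independent of \<open>d\<close>, the two draws
    commute.\<close>
  also have "\<dots> = bind_pmf p1 (\<lambda>M. bind_pmf ?p (\<lambda>d. map_pmf (\<lambda>M'. M \<union> M') (p2 d M)))"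
    by (rule bind_commute_pmf)
  finally have out: "output_matching ?G \<pi> = \<dots>" .
  have first: "(\<integral>\<^sup>+ d. \<integral>\<^sup>+ M'. ennreal (real (card (M \<union> M'))) \<partial>p2 d M \<partial>?p) \<le> ennreal (real m / 2)"
    if "M \<in> set_pmf p1" for M
  proof -
    have "matching {e \<in> edges ?G. e \<subseteq> {..<m}} M"
      using that \<pi> unfolding valid_policy_def p1_def by blast
    then have M: "pairwise disjnt M" "\<And>e. e \<in> M \<Longrightarrow> e \<subseteq> {..<m} \<and> card e = 2"
      by (auto simp: matching_def)
    have UM: "\<Union>M \<subseteq> {..<m}" using M(2) by blast
    have cU: "card (\<Union>M) = 2 * card M" using M card_Union_matching by blast
    have "card (\<Union>M) \<le> m" using card_mono[OF _ UM] by simp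
    moreover have "card ({..<m} - \<Union>M) = m - card (\<Union>M)"
      using UM finite_subset by (subst card_Diff_subset) auto
    ultimately have cR: "real (card ({..<m} - \<Union>M)) = real m - 2 * real (card M)"
      using cU by simp
    let ?X = "\<lambda>d. {v \<in> {..<m} - \<Union>M. d v = 2}"
    have "(\<integral>\<^sup>+ d. \<integral>\<^sup>+ M'. ennreal (real (card (M \<union> M'))) \<partial>p2 d M \<partial>?p)
        \<le> (\<integral>\<^sup>+ d. ennreal (real (card M) + real (card (?X d))) \<partial>?p)"
    proof (rule nn_integral_mono_AE, unfold AE_measure_pmf_iff, intro ballI)
      fix d assume d: "d \<in> set_pmf ?p"
      have "real (card (M \<union> M')) \<le> real (card M) + real (card (?X d))" if "M' \<in> set_pmf (p2 d M)" for M'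
      proof -
        have "card M' \<le> card (?X d)"
          using second_round_bound[OF d] \<pi> that unfolding valid_policy_def p2_def by blast
        then show ?thesis using card_Un_le[of M M'] by linarith
      qed
      then have "(\<integral>\<^sup>+ M'. ennreal (real (card (M \<union> M'))) \<partial>p2 d M)
          \<le> (\<integral>\<^sup>+ M'. ennreal (real (card M) + real (card (?X d))) \<partial>p2 d M)"
        by (intro nn_integral_mono_AE) (auto simp: AE_measure_pmf_iff intro!: ennreal_leI simp del: ennreal_plus)
      then show "(\<integral>\<^sup>+ M'. ennreal (real (card (M \<union> M'))) \<partial>p2 d M)
          \<le> ennreal (real (card M) + real (card (?X d)))" by simp
    qed
    also have "\<dots> = ennreal (measure_pmf.expectation ?p (\<lambda>d. real (card M) + real (card (?X d))))"
      by (intro nn_integral_eq_integral integrable_measure_pmf_finite finite_set_death_times) auto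
    \<comment> \<open>The size of \<open>M\<close> cancels: its edges use up
      \<open>2 * card M\<close> clique vertices, of which half would survive on average.\<close>
    also have "measure_pmf.expectation ?p (\<lambda>d. real (card M) + real (card (?X d))) = real m / 2"
      using expected_survivors[of "{..<m} - \<Union>M" m] cR
      by (simp add: integrable_measure_pmf_finite finite_set_death_times field_simps)
    finally show ?thesis .
  qed
  have "(\<integral>\<^sup>+ M. ennreal (real (card M)) \<partial>output_matching ?G \<pi>)
      = (\<integral>\<^sup>+ M. \<integral>\<^sup>+ d. \<integral>\<^sup>+ M'. ennreal (real (card (M \<union> M'))) \<partial>p2 d M \<partial>?p \<partial>p1)"
    by (simp add: out)
  also have "\<dots> \<le> (\<integral>\<^sup>+ M. ennreal (real m / 2) \<partial>p1)"
    using first by (intro nn_integral_mono_AE) (auto simp: AE_measure_pmf_iff)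
  finally show "(\<integral>\<^sup>+ M. ennreal (real (card M)) \<partial>output_matching ?G \<pi>) \<le> ennreal (real m / 2)"
    by simp
qed simp

section \<open>Passage to the limit in the clique size\<close>

theorem theorem3: "phi_star \<le> 2 / 3"
proof (rule LIMSEQ_le_const)
  show "(\<lambda>m. (real m / 2) / (3 * real m / 4 - 1 / 2)) \<longlonglongrightarrow> 2 / 3"
    by real_asymp
  \<comment> \<open>Each of these bounds exceeds \<open>2 / 3\<close>, which is reached only in the
    limit. From \<open>m = 1\<close> on the denominator is positive, which also gives
    \<open>opt ?G > 0\<close>.\<close>
  have "phi_star \<le> (real m / 2) / (3 * real m / 4 - 1 / 2)" if "m \<ge> 1" for m
  proof -
    let ?G = "clique_with_pendants m"
    have lower: "0 < 3 * real m / 4 - 1 / 2" "3 * real m / 4 - 1 / 2 \<le> opt ?G"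
      using that opt_lower_bound[of m] by auto
    have "chi_star ?G \<le> real m / 2"
      using that policy_value_clique_with_pendants by (intro chi_star_le) auto
    then have "chi_star ?G / opt ?G \<le> (real m / 2) / (3 * real m / 4 - 1 / 2)"
      using lower by (intro frac_le) auto
    moreover have "phi_star \<le> chi_star ?G / opt ?G"
      using lower by (intro phi_star_le model_clique_with_pendants) auto
    ultimately show ?thesis by linarith
  qed
  then show "\<exists>N. \<forall>n\<ge>N. phi_star \<le> (real n / 2) / (3 * real n / 4 - 1 / 2)"
    by blast
qed

end
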